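(* Let $\Omega\subset\mathbb{R}^n$ be an open set, $1\leq p<\infty$ and $f\in W^1_{p,\mathrm{loc}}(\Omega)$. Let $x\in\Omega$ be an $L_p$-point of $f$. If $f$ is $W^1_p$-differentiable at $x$ with formal differential $Df(x)$, then $f$ is $L_p$-differentiable at $x$ and its $L_p$-differential satisfies $D_pf(x)=Df(x)$. In particular, $f$ is approximately differentiable at $x$.
   Context: $B(x,r)$ is the open ball with center $x$ and radius $r$, and $\frac{1}{|B(x,r)|}\int_{B(x,r)}$ denotes the average. $|\cdot|$ of a set is $n$-dimensional Lebesgue measure. Functions are real-valued. Precise representative: for $f\in L_{1,\mathrm{loc}}(\Omega)$, $f^*:\Omega\to\mathbb{R}$ is $f^*(x)=\lim_{r\to0^+}\frac{1}{|B(x,r)|}\int_{B(x,r)}f(y)\,dy$ if the limit exists and is real, and $f^*(x)=0$ otherwise. $L_p$-point: for $f\in L_{p,\mathrm{loc}}(\Omega)$, a point $x\in\Omega$ is an $L_p$-point of $f$ if the limit $f^*(x)=\lim_{r\to0^+}\frac{1}{|B(x,r)|}\int_{B(x,r)}f(z)\,dz$ exists in $\mathbb{R}$ and $\lim_{r\to 0^+}\frac{1}{|B(x,r)|}\int_{B(x,r)}|f(z)-f^*(x)|^p\,dz=0$. $L_p$-differentiability: $f\in L_{p,\mathrm{loc}}(\Omega)$ is $L_p$-differentiable at $x\in\Omega$ if there is a linear map $L:\mathbb{R}^n\to\mathbb{R}$ with $\lim_{r\to0^+}\frac{1}{|B(x,r)|}\int_{B(x,r)}\frac{|f(z)-f^*(x)-L(z-x)|^p}{r^p}\,dz=0$;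 this (unique) $L$ is the $L_p$-differential $D_pf(x)$. Approximate differentiability: a measurable $f:\Omega\to\mathbb{R}$ is approximately differentiable at $x\in\Omega$ if there exist $z\in\mathbb{R}$ and a linear map $L:\mathbb{R}^n\to\mathbb{R}$ such that for every $\varepsilon>0$ the set $A_\varepsilon=\{y\in\Omega\setminus\{x\}: |f(y)-z-L(y-x)|/|y-x|>\varepsilon\}$ has Lebesgue density zero at $x$, i.e. $\lim_{r\to 0^+}|A_\varepsilon\cap B(x,r)|/|B(x,r)|=0$. Sobolev norm: $\|f\|_{W^1_p(U)}=\sum_{|\alpha|\le1}\|D^\alpha f\|_{L_p(U)}$, with weak derivatives. $W^1_p$-differentiability: for $f\in W^1_{p,\mathrm{loc}}(\Omega)$ and $x\in\Omega$ an $L_p$-point of $f$, $f$ is $W^1_p$-differentiable at $x$ if there is a linear map $L:\mathbb{R}^n\to\mathbb{R}$ such that for every open bounded $U\subset\mathbb{R}^n$, $\lim_{h\to0}\|f_{x,h}-L\|_{W^1_p(U)}=0$, where $f_{x,h}(z)=\frac{f^*(x+hz)-f^*(x)}{h}$ for $h\in\mathbb{R}\setminus\{0\}$, $z\in\frac{\Omega-x}{h}$ (this is defined on $U$ for $|h|$ small). $L$ is called the formal differential, denoted $Df(x)$. *)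

theory Defs
  imports "HOL-Analysis.Analysis"
begin

text \<open>
  The space is an arbitrary Euclidean space of dimension \<open>n \<ge> 1\<close>. A function on \<open>\<Omega>\<close> is a total
  function whose values outside \<open>\<Omega>\<close> are irrelevant: everything below only looks at balls and sets
  inside \<open>\<Omega>\<close>, eventually as the radius or \<open>h\<close> tends to 0.
\<close>

definition Lp :: "real \<Rightarrow> 'a::euclidean_space set \<Rightarrow> ('a \<Rightarrow> real) set" where
  "Lp p U = {f. set_borel_measurable lebesgue U f \<and>
                set_integrable lebesgue U (\<lambda>y. \<bar>f y\<bar> powr p)}"

definition Lp_norm :: "real \<Rightarrow> 'a::euclidean_space set \<Rightarrow> ('a \<Rightarrow> real) \<Rightarrow> real" where
  "Lp_norm p U f = (LINT y:U|lebesgue. \<bar>f y\<bar> powr p) powr (1 / p)"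

definition compactly_in :: "'a::euclidean_space set \<Rightarrow> 'a set \<Rightarrow> bool" where
  "compactly_in V \<Omega> \<longleftrightarrow> open V \<and> compact (closure V) \<and> closure V \<subseteq> \<Omega>"

definition Lp_loc :: "real \<Rightarrow> 'a::euclidean_space set \<Rightarrow> ('a \<Rightarrow> real) set" where
  "Lp_loc p \<Omega> = {f. \<forall>V. compactly_in V \<Omega> \<longrightarrow> f \<in> Lp p V}"

definition pderiv_at :: "'a::euclidean_space \<Rightarrow> ('a \<Rightarrow> real) \<Rightarrow> 'a \<Rightarrow> real" where
  "pderiv_at b \<phi> x = frechet_derivative \<phi> (at x) b"

fun Ck :: "nat \<Rightarrow> ('a::euclidean_space \<Rightarrow> real) \<Rightarrow> bool" where
  "Ck 0 \<phi> \<longleftrightarrow> continuous_on UNIV \<phi>"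
| "Ck (Suc k) \<phi> \<longleftrightarrow> (\<forall>x. \<phi> differentiable (at x)) \<and> (\<forall>b\<in>Basis. Ck k (pderiv_at b \<phi>))"

definition test_function :: "'a::euclidean_space set \<Rightarrow> ('a \<Rightarrow> real) \<Rightarrow> bool" where
  "test_function U \<phi> \<longleftrightarrow>
     (\<forall>k. Ck k \<phi>) \<and> compact (closure {x. \<phi> x \<noteq> 0}) \<and> closure {x. \<phi> x \<noteq> 0} \<subseteq> U"

definition has_weak_pderiv ::
    "'a::euclidean_space set \<Rightarrow> 'a \<Rightarrow> ('a \<Rightarrow> real) \<Rightarrow> ('a \<Rightarrow> real) \<Rightarrow> bool" where
  "has_weak_pderiv U b f g \<longleftrightarrow>
     f \<in> Lp_loc 1 U \<and> g \<in> Lp_loc 1 U \<and>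
     (\<forall>\<phi>. test_function U \<phi> \<longrightarrow>
        (LINT y:U|lebesgue. f y * pderiv_at b \<phi> y) = - (LINT y:U|lebesgue. g y * \<phi> y))"

text \<open>The weak derivative is unique only up to null sets; the choice does not affect \<open>L\<^sub>p\<close> norms.\<close>

definition weak_pderiv :: "'a::euclidean_space set \<Rightarrow> 'a \<Rightarrow> ('a \<Rightarrow> real) \<Rightarrow> 'a \<Rightarrow> real" where
  "weak_pderiv U b f = (SOME g. has_weak_pderiv U b f g)"

definition W1p :: "real \<Rightarrow> 'a::euclidean_space set \<Rightarrow> ('a \<Rightarrow> real) set" where
  "W1p p U = {f \<in> Lp p U. \<forall>b\<in>Basis. \<exists>g \<in> Lp p U. has_weak_pderiv U b f g}"

definition W1p_loc :: "real \<Rightarrow> 'a::euclidean_space set \<Rightarrow> ('a \<Rightarrow> real) set" where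
  "W1p_loc p \<Omega> = {f. \<forall>V. compactly_in V \<Omega> \<longrightarrow> f \<in> W1p p V}"

text \<open>The multi-indices of order at most 1 are 0 and the unit ones, hence the sum over \<open>Basis\<close>.
  Off the space \<open>W\<^sup>1\<^sub>p(U)\<close> the norm is infinite, so that the value 0 which the library gives to
  divergent integrals cannot interfere.\<close>

definition W1p_norm :: "real \<Rightarrow> 'a::euclidean_space set \<Rightarrow> ('a \<Rightarrow> real) \<Rightarrow> ennreal" where
  "W1p_norm p U f =
     (if f \<in> W1p p U
      then ennreal (Lp_norm p U f + (\<Sum>b\<in>Basis. Lp_norm p U (weak_pderiv U b f)))
      else \<infinity>)"

definition ball_avg :: "('a::euclidean_space \<Rightarrow> real) \<Rightarrow> 'a \<Rightarrow> real \<Rightarrow> real" where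
  "ball_avg f x r = (LINT y:ball x r|lebesgue. f y) / measure lebesgue (ball x r)"

definition precise_rep :: "('a::euclidean_space \<Rightarrow> real) \<Rightarrow> 'a \<Rightarrow> real" where
  "precise_rep f x =
     (if \<exists>l. (ball_avg f x \<longlongrightarrow> l) (at_right 0) then Lim (at_right 0) (ball_avg f x) else 0)"

definition Lp_point :: "real \<Rightarrow> 'a::euclidean_space set \<Rightarrow> ('a \<Rightarrow> real) \<Rightarrow> 'a \<Rightarrow> bool" where
  "Lp_point p \<Omega> f x \<longleftrightarrow>
     f \<in> Lp_loc p \<Omega> \<and> x \<in> \<Omega> \<and>
     (\<exists>l. (ball_avg f x \<longlongrightarrow> l) (at_right 0)) \<and>
     ((\<lambda>r. ball_avg (\<lambda>z. \<bar>f z - precise_rep f x\<bar> powr p) x r) \<longlongrightarrow> 0) (at_right 0)"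

definition has_Lp_differential ::
    "real \<Rightarrow> 'a::euclidean_space set \<Rightarrow> ('a \<Rightarrow> real) \<Rightarrow> 'a \<Rightarrow> ('a \<Rightarrow> real) \<Rightarrow> bool" where
  "has_Lp_differential p \<Omega> f x L \<longleftrightarrow>
     f \<in> Lp_loc p \<Omega> \<and> x \<in> \<Omega> \<and> linear L \<and>
     ((\<lambda>r. ball_avg (\<lambda>z. \<bar>f z - precise_rep f x - L (z - x)\<bar> powr p / r powr p) x r)
        \<longlongrightarrow> 0) (at_right 0)"

definition Lp_differentiable ::
    "real \<Rightarrow> 'a::euclidean_space set \<Rightarrow> ('a \<Rightarrow> real) \<Rightarrow> 'a \<Rightarrow> bool" where
  "Lp_differentiable p \<Omega> f x \<longleftrightarrow> (\<exists>L. has_Lp_differential p \<Omega> f x L)"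

definition Lp_differential ::
    "real \<Rightarrow> 'a::euclidean_space set \<Rightarrow> ('a \<Rightarrow> real) \<Rightarrow> 'a \<Rightarrow> 'a \<Rightarrow> real" where
  "Lp_differential p \<Omega> f x = (THE L. has_Lp_differential p \<Omega> f x L)"

definition approx_differentiable ::
    "'a::euclidean_space set \<Rightarrow> ('a \<Rightarrow> real) \<Rightarrow> 'a \<Rightarrow> bool" where
  "approx_differentiable \<Omega> f x \<longleftrightarrow>
     set_borel_measurable lebesgue \<Omega> f \<and> x \<in> \<Omega> \<and>
     (\<exists>z L. linear L \<and>
        (\<forall>\<epsilon>>0. ((\<lambda>r. measure lebesgue
                      ({y \<in> \<Omega> - {x}. \<bar>f y - z - L (y - x)\<bar> / norm (y - x) > \<epsilon>} \<inter> ball x r)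
                    / measure lebesgue (ball x r)) \<longlongrightarrow> 0) (at_right 0)))"

definition rescaled :: "('a::euclidean_space \<Rightarrow> real) \<Rightarrow> 'a \<Rightarrow> real \<Rightarrow> 'a \<Rightarrow> real" where
  "rescaled f x h z = (precise_rep f (x + h *\<^sub>R z) - precise_rep f x) / h"

definition has_formal_differential ::
    "real \<Rightarrow> 'a::euclidean_space set \<Rightarrow> ('a \<Rightarrow> real) \<Rightarrow> 'a \<Rightarrow> ('a \<Rightarrow> real) \<Rightarrow> bool" where
  "has_formal_differential p \<Omega> f x L \<longleftrightarrow>
     f \<in> W1p_loc p \<Omega> \<and> Lp_point p \<Omega> f x \<and> linear L \<and>
     (\<forall>U. open U \<and> bounded U \<longrightarrow>
        ((\<lambda>h. W1p_norm p U (\<lambda>z. rescaled f x h z - L z)) \<longlongrightarrow> 0) (at 0))"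

definition W1p_differentiable ::
    "real \<Rightarrow> 'a::euclidean_space set \<Rightarrow> ('a \<Rightarrow> real) \<Rightarrow> 'a \<Rightarrow> bool" where
  "W1p_differentiable p \<Omega> f x \<longleftrightarrow> (\<exists>L. has_formal_differential p \<Omega> f x L)"

definition formal_differential ::
    "real \<Rightarrow> 'a::euclidean_space set \<Rightarrow> ('a \<Rightarrow> real) \<Rightarrow> 'a \<Rightarrow> 'a \<Rightarrow> real" where
  "formal_differential p \<Omega> f x = (THE L. has_formal_differential p \<Omega> f x L)"

end

theory Submission
  imports Defs
begin

text \<open>
  Substituting \<open>y = x + h z\<close> turns the average of \<open>|f(y) - f\<^sup>*(x) - L(y - x)|\<^sup>p / h\<^sup>p\<close> over \<open>B(x,h)\<close>
  into the average of \<open>|f\<^sub>x\<^sub>,\<^sub>h - L|\<^sup>p\<close> over the unit ball, provided that \<open>f\<close> may be replaced by \<open>f\<^sup>*\<close>;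
  this is the Lebesgue differentiation theorem for balls. Only the \<open>L\<^sub>p\<close> part of the Sobolev norm
  on the unit ball is used. Formal differentials are therefore \<open>L\<^sub>p\<close>-differentials, and these are
  unique since the average of \<open>|M(y - x)|\<^sup>p / r\<^sup>p\<close> over \<open>B(x,r)\<close> does not depend on \<open>r\<close> for linear \<open>M\<close>.
  For approximate differentiability, Chebyshev's inequality controls the exceptional set outside
  \<open>B(x, \<delta> r)\<close>, and \<open>B(x, \<delta> r)\<close> only contributes the density \<open>\<delta>\<^sup>n\<close>.
\<close>

section \<open>Diagonal changes of variables\<close>

text \<open>Lebesgue measure is the image of itself under \<open>T\<close> with the constant density
  \<open>\<Prod>j\<in>Basis. \<bar>c j\<bar>\<close>; all three claims are read off from this
  identity. Each coordinate has its own coefficient, of either sign, so that homotheties and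
  coordinate reflections are both covered.\<close>

lemma lebesgue_affine_diagonal:
  fixes c :: "'a::euclidean_space \<Rightarrow> real" and t :: 'a
  assumes c: "\<And>j. j \<in> Basis \<Longrightarrow> c j \<noteq> 0"
  defines "T \<equiv> (\<lambda>x. t + (\<Sum>j\<in>Basis. (c j * (x \<bullet> j)) *\<^sub>R j))"
  shows AE_lebesgue_affine_diagonal: "(AE x in lebesgue. P x) \<Longrightarrow> (AE x in lebesgue. P (T x))"
    and integral_lebesgue_affine_diagonal: "g \<in> borel_measurable lebesgue \<Longrightarrow>
      (LINT x|lebesgue. g x) = (\<Prod>j\<in>Basis. \<bar>c j\<bar>) * (LINT x|lebesgue. g (T x) :: real)"
    and integrable_lebesgue_affine_diagonal: "integrable lebesgue g \<Longrightarrow>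
      integrable lebesgue (\<lambda>x. g (T x) :: real)"
proof -
  let ?k = "\<Prod>j\<in>Basis. \<bar>c j\<bar>"
  have k: "?k > 0" using c by (intro prod_pos) auto
  have eq: "lebesgue = density (distr lebesgue lebesgue T) (\<lambda>_. ennreal ?k)"
    unfolding T_def by (rule lebesgue_affine_euclidean[OF c])
  have T[measurable]: "T \<in> lebesgue \<rightarrow>\<^sub>M lebesgue"
    unfolding T_def by (rule lebesgue_affine_measurable[OF c])
  show "AE x in lebesgue. P (T x)" if P: "AE x in lebesgue. P x"
  proof -
    have "AE x in density (distr lebesgue lebesgue T) (\<lambda>_. ennreal ?k). P x"
      using P eq by metis
    then have "AE x in distr lebesgue lebesgue T. P x"
      using k by (subst (asm) AE_density) auto
    then show ?thesis by (rule AE_distrD[OF T])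
  qed
  show "(LINT x|lebesgue. g x) = ?k * (LINT x|lebesgue. g (T x))"
    if g[measurable]: "g \<in> borel_measurable lebesgue" for g :: "'a \<Rightarrow> real"
  proof -
    have "(LINT x|lebesgue. g x) = (LINT x|density (distr lebesgue lebesgue T) (\<lambda>_. ennreal ?k). g x)"
      using eq by metis
    also have "\<dots> = (LINT x|distr lebesgue lebesgue T. ?k *\<^sub>R g x)"
      using k by (intro integral_density) auto
    also have "\<dots> = (LINT x|lebesgue. ?k *\<^sub>R g (T x))"
      by (intro integral_distr) auto
    finally show ?thesis by simp
  qed
  show "integrable lebesgue (\<lambda>x. g (T x))" if g: "integrable lebesgue g" for g :: "'a \<Rightarrow> real"
  proof -
    note [measurable] = borel_measurable_integrable[OF g]
    have "integrable (density (distr lebesgue lebesgue T) (\<lambda>_. ennreal ?k)) g"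
      using g eq by metis
    then have "integrable (distr lebesgue lebesgue T) (\<lambda>x. ?k *\<^sub>R g x)"
      using k by (subst (asm) integrable_density) auto
    then have "integrable lebesgue (\<lambda>x. ?k *\<^sub>R g (T x))"
      by (rule integrable_distr[OF T])
    then show ?thesis using c by auto
  qed
qed

lemma lebesgue_homothety:
  fixes t :: "'a::euclidean_space" and r :: real
  assumes "r > 0"
  shows AE_lebesgue_homothety: "(AE x in lebesgue. P x) \<Longrightarrow> (AE x in lebesgue. P (t + r *\<^sub>R x))"
    and integral_lebesgue_homothety: "g \<in> borel_measurable lebesgue \<Longrightarrow>
      (LINT x|lebesgue. g x) = r ^ DIM('a) * (LINT x|lebesgue. g (t + r *\<^sub>R x) :: real)"
proof -
  have T: "t + (\<Sum>j\<in>Basis. (r * (x \<bullet> j)) *\<^sub>R j) = t + r *\<^sub>R x" for x :: 'a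
  proof -
    have "(\<Sum>j\<in>Basis. (r * (x \<bullet> j)) *\<^sub>R j) = r *\<^sub>R (\<Sum>j\<in>Basis. (x \<bullet> j) *\<^sub>R j)"
      by (simp only: scaleR_sum_right scaleR_scaleR)
    then show ?thesis by (simp only: euclidean_representation)
  qed
  show "AE x in lebesgue. P (t + r *\<^sub>R x)" if "AE x in lebesgue. P x"
    using AE_lebesgue_affine_diagonal[of "\<lambda>_. r" P t] assms that by (simp add: T)
  show "(LINT x|lebesgue. g x) = r ^ DIM('a) * (LINT x|lebesgue. g (t + r *\<^sub>R x))"
    if "g \<in> borel_measurable lebesgue" for g :: "'a \<Rightarrow> real"
    using integral_lebesgue_affine_diagonal[of "\<lambda>_. r" g t] assms that by (simp add: T)
qed

text \<open>The set \<open>S\<close> encodes an orthant: it lists the coordinates whose sign is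
  flipped. The sum over \<open>Basis\<close> makes the map an instance of \<open>T\<close> above
  with coefficients 1 and -1, so that it preserves Lebesgue measure.\<close>

definition reflect :: "'a::euclidean_space set \<Rightarrow> 'a \<Rightarrow> 'a" where
  "reflect S x = (\<Sum>j\<in>Basis. ((if j \<in> S then -1 else 1) * (x \<bullet> j)) *\<^sub>R j)"

lemma inner_reflect: "i \<in> Basis \<Longrightarrow> reflect S x \<bullet> i = (if i \<in> S then - (x \<bullet> i) else x \<bullet> i)"
  by (simp add: reflect_def)

lemma reflect_reflect [simp]: "reflect S (reflect S x) = x"
  by (rule euclidean_eqI) (simp add: inner_reflect)

lemma lebesgue_reflect:
  fixes S :: "'a::euclidean_space set"
  shows AE_lebesgue_reflect: "(AE x in lebesgue. P x) \<Longrightarrow> (AE x in lebesgue. P (reflect S x))"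
    and integral_lebesgue_reflect: "g \<in> borel_measurable lebesgue \<Longrightarrow>
      (LINT x|lebesgue. g x) = (LINT x|lebesgue. g (reflect S x) :: real)"
    and integrable_lebesgue_reflect: "integrable lebesgue g \<Longrightarrow>
      integrable lebesgue (\<lambda>x. g (reflect S x) :: real)"
proof -
  let ?c = "\<lambda>j. (if j \<in> S then -1 else 1) :: real"
  have p: "(\<Prod>j\<in>Basis. \<bar>?c (j::'a)\<bar>) = 1" by (intro prod.neutral) auto
  note D = lebesgue_affine_diagonal[of ?c, where t = 0, unfolded p add_0_left mult_1_left, folded reflect_def]
  show "(AE x in lebesgue. P x) \<Longrightarrow> (AE x in lebesgue. P (reflect S x))"
    by (rule D(1)) auto
  show "g \<in> borel_measurable lebesgue \<Longrightarrow>
      (LINT x|lebesgue. g x) = (LINT x|lebesgue. g (reflect S x) :: real)"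
    by (rule D(2)) auto
  show "integrable lebesgue g \<Longrightarrow> integrable lebesgue (\<lambda>x. g (reflect S x) :: real)"
    by (rule D(3)) auto
qed

lemma continuous_on_reflect: "continuous_on S (reflect R)"
  unfolding reflect_def by (intro continuous_intros)

section \<open>Upper bounds for integrals over small cubes and balls\<close>

text \<open>This is the upper half of Lebesgue differentiation for cubes whose lower corner is
  \<open>x\<close>. It is kept as an upper bound, multiplied out by the volume, because such bounds
  can be added over several cubes that cover a ball.\<close>

lemma cube_integral_le_AE:
  fixes g :: "'a::euclidean_space \<Rightarrow> real"
  assumes int: "\<And>K. compact K \<Longrightarrow> set_integrable lebesgue K g"
  shows "AE x in lebesgue. \<forall>e>0. eventually
    (\<lambda>h. (LINT y:cbox x (x + h *\<^sub>R One)|lebesgue. g y) \<le> h ^ DIM('a) * (g x + e)) (at_right 0)"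
proof -
  have "g integrable_on cbox a b" for a b
    by (rule set_lebesgue_integral_eq_integral(1)[OF int]) simp
  then obtain N where N: "negligible N"
    "\<And>x e. \<lbrakk>x \<notin> N; 0 < e\<rbrakk> \<Longrightarrow> \<exists>d>0. \<forall>h. 0 < h \<and> h < d \<longrightarrow>
       norm (integral (cbox x (x + h *\<^sub>R One)) g /\<^sub>R h ^ DIM('a) - g x) < e"
    using integrable_ccontinuous_explicit[of g] by metis
  have "eventually (\<lambda>h. (LINT y:cbox x (x + h *\<^sub>R One)|lebesgue. g y) \<le> h ^ DIM('a) * (g x + e)) (at_right 0)"
    if x: "x \<notin> N" and e: "e > 0" for x e
  proof -
    obtain d where d: "d > 0" "\<And>h. 0 < h \<Longrightarrow> h < d \<Longrightarrow>
       norm (integral (cbox x (x + h *\<^sub>R One)) g /\<^sub>R h ^ DIM('a) - g x) < e"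
      using N(2)[OF x e] by blast
    show ?thesis unfolding eventually_at_right_field
    proof (intro exI[of _ d] conjI allI impI d(1))
      fix h assume h: "h > (0::real)" "h < d"
      have "integral (cbox x (x + h *\<^sub>R One)) g / h ^ DIM('a) < g x + e"
        using d(2)[OF h] by (simp add: abs_less_iff divide_inverse mult.commute)
      then show "(LINT y:cbox x (x + h *\<^sub>R One)|lebesgue. g y) \<le> h ^ DIM('a) * (g x + e)"
        using h set_lebesgue_integral_eq_integral(2)[OF int, of "cbox x (x + h *\<^sub>R One)"]
        by (simp add: field_simps)
    qed
  qed
  moreover have "AE x in lebesgue. x \<notin> N"
    using N(1) by (intro AE_not_in) (simp add: negligible_iff_null_sets)
  ultimately show ?thesis by (elim AE_mp) auto
qed

text \<open>The ball is covered by the \<open>2\<^sup>n\<close> cubes with corner \<open>x\<close>, one in each orthant; reflections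
  reduce them to the positive orthant.\<close>

lemma ball_integral_le_AE:
  fixes g :: "'a::euclidean_space \<Rightarrow> real"
  assumes int: "\<And>K. compact K \<Longrightarrow> set_integrable lebesgue K g" and nn: "\<And>y. 0 \<le> g y"
  shows "AE x in lebesgue. \<forall>e>0. eventually
    (\<lambda>h. (LINT y:ball x h|lebesgue. g y) \<le> (2 * h) ^ DIM('a) * (g x + e)) (at_right 0)"
proof -
  \<comment> \<open>\<open>Q S x h\<close> is the cube of side \<open>h\<close> with corner
    \<open>x\<close> that extends downwards in the coordinates of \<open>S\<close> and upwards in
    the others.\<close>
  define Q :: "'a set \<Rightarrow> 'a \<Rightarrow> real \<Rightarrow> 'a set" where
    "Q S x h = reflect S ` cbox (reflect S x) (reflect S x + h *\<^sub>R One)" for S x h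
  have compQ: "compact (Q S x h)" for S x h
    unfolding Q_def by (intro compact_continuous_image continuous_on_reflect compact_cbox)
  have indQ: "indicator (Q S x h) y = (indicator (cbox (reflect S x) (reflect S x + h *\<^sub>R One)) (reflect S y) :: real)"
    for S x h y
    unfolding Q_def by (auto simp: indicator_def image_iff) (metis reflect_reflect)
  have *: "AE x in lebesgue. \<forall>e>0. eventually
      (\<lambda>h. (LINT y:Q S x h|lebesgue. g y) \<le> h ^ DIM('a) * (g x + e)) (at_right 0)" for S
  proof -
    have intS: "set_integrable lebesgue K (\<lambda>y. g (reflect S y))" if K: "compact K" for K
    proof -
      have "set_integrable lebesgue (reflect S ` K) g"
        by (intro int compact_continuous_image continuous_on_reflect K)
      then have "integrable lebesgue (\<lambda>y. indicator (reflect S ` K) (reflect S y) *\<^sub>R g (reflect S y))"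
        unfolding set_integrable_def by (rule integrable_lebesgue_reflect)
      moreover have "indicator (reflect S ` K) (reflect S y) = (indicator K y :: real)" for y
        by (auto simp: indicator_def image_iff) (metis reflect_reflect)
      ultimately show ?thesis by (simp add: set_integrable_def)
    qed
    have eq: "(LINT y:cbox (reflect S x) (reflect S x + h *\<^sub>R One)|lebesgue. g (reflect S y))
        = (LINT y:Q S x h|lebesgue. g y)" for x h
      unfolding set_lebesgue_integral_def
      using integral_lebesgue_reflect[OF borel_measurable_integrable[OF
            int[OF compQ[of S x h], unfolded set_integrable_def]], of S]
      by (simp add: indQ)
    \<comment> \<open>The cube bound is applied to \<open>g\<close> composed with the reflection, at
      the point \<open>reflect S x\<close>. Reflections preserve null sets, and the value of the
      composite at \<open>reflect S x\<close> is \<open>g x\<close>.\<close>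
    show ?thesis
      using AE_lebesgue_reflect[OF cube_integral_le_AE[OF intS], of S] by (simp add: eq)
  qed
  have "AE x in lebesgue. \<forall>S\<in>Pow Basis. \<forall>e>0. eventually
      (\<lambda>h. (LINT y:Q S x h|lebesgue. g y) \<le> h ^ DIM('a) * (g x + e)) (at_right 0)"
    by (intro AE_finite_allI *) auto
  then show ?thesis
  proof (elim AE_mp, intro AE_I2 impI allI)
    fix x :: 'a and e :: real
    assume A: "\<forall>S\<in>Pow Basis. \<forall>e>0. eventually
      (\<lambda>h. (LINT y:Q S x h|lebesgue. g y) \<le> h ^ DIM('a) * (g x + e)) (at_right 0)" and e: "e > 0"
    have "eventually (\<lambda>h. \<forall>S\<in>Pow Basis. (LINT y:Q S x h|lebesgue. g y) \<le> h ^ DIM('a) * (g x + e)) (at_right 0)"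
      using A e by (intro eventually_ball_finite) auto
    moreover have "eventually (\<lambda>h. h > (0::real)) (at_right 0)"
      by (rule eventually_at_right_less)
    ultimately show "eventually (\<lambda>h. (LINT y:ball x h|lebesgue. g y) \<le> (2 * h) ^ DIM('a) * (g x + e)) (at_right 0)"
    proof eventually_elim
      case (elim h)
      have iQ: "integrable lebesgue (\<lambda>y. indicator (Q S x h) y *\<^sub>R g y)" for S
        using int[OF compQ] by (simp add: set_integrable_def)
      have ib: "set_integrable lebesgue (ball x h) g"
        by (rule set_integrable_subset[OF int[of "cball x h"]]) auto
      \<comment> \<open>Overlaps of the cubes and their parts outside the ball only enlarge the
        right side, as \<open>g\<close> is nonnegative.\<close>
      have le: "indicator (ball x h) y *\<^sub>R g y \<le> (\<Sum>S\<in>Pow Basis. indicator (Q S x h) y *\<^sub>R g y)" for y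
      proof (cases "y \<in> ball x h")
        case True
        \<comment> \<open>This set names the orthant at \<open>x\<close> that contains
          \<open>y\<close>.\<close>
        let ?S = "{i\<in>Basis. y \<bullet> i < x \<bullet> i}"
        have "\<bar>(y - x) \<bullet> i\<bar> < h" if "i \<in> Basis" for i
          using True Basis_le_norm[OF that, of "y - x"] by (simp add: dist_norm norm_minus_commute)
        then have "reflect ?S y \<in> cbox (reflect ?S x) (reflect ?S x + h *\<^sub>R One)"
          by (fastforce simp: mem_box inner_reflect inner_add_left inner_diff_left)
        then have "indicator (ball x h) y *\<^sub>R g y = indicator (Q ?S x h) y *\<^sub>R g y"
          using True by (simp add: indQ)
        also have "indicator (Q ?S x h) y *\<^sub>R g y \<le> (\<Sum>S\<in>Pow Basis. indicator (Q S x h) y *\<^sub>R g y)"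
          by (rule member_le_sum) (auto simp: nn)
        finally show ?thesis .
      qed (auto intro!: sum_nonneg simp: nn)
      have "(LINT y:ball x h|lebesgue. g y) \<le> (LINT y|lebesgue. (\<Sum>S\<in>Pow Basis. indicator (Q S x h) y *\<^sub>R g y))"
        unfolding set_lebesgue_integral_def
        using ib iQ by (intro integral_mono Bochner_Integration.integrable_sum le) (auto simp: set_integrable_def)
      also have "\<dots> = (\<Sum>S\<in>Pow Basis. (LINT y:Q S x h|lebesgue. g y))"
        unfolding set_lebesgue_integral_def using iQ by (intro Bochner_Integration.integral_sum)
      also have "\<dots> \<le> (\<Sum>S\<in>Pow (Basis::'a set). h ^ DIM('a) * (g x + e))"
        using elim by (intro sum_mono) auto
      \<comment> \<open>There are \<open>2 ^ DIM('a)\<close> orthants, one for each subset of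
        \<open>Basis\<close>.\<close>
      also have "\<dots> = (2 * h) ^ DIM('a) * (g x + e)"
        by (simp add: card_Pow power_mult_distrib)
      finally show ?case .
    qed
  qed
qed

section \<open>Averages over balls and Lebesgue differentiation\<close>

lemma measure_ball_eq:
  "r \<ge> 0 \<Longrightarrow> measure lebesgue (ball (x::'a::euclidean_space) r) = r ^ DIM('a) * measure lebesgue (ball (0::'a) 1)"
  using content_ball_conv_unit_ball[of r x] by simp

lemma measure_ball_pos: "r > 0 \<Longrightarrow> measure lebesgue (ball (x::'a::euclidean_space) r) > 0"
  using content_ball_pos[of r x] by simp

lemma ball_avg_const: "r > 0 \<Longrightarrow> ball_avg (\<lambda>_. c) x r = c"
  using measure_ball_pos[of r x]
  by (simp add: ball_avg_def set_lebesgue_integral_def)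

lemma ball_avg_mono:
  assumes "set_integrable lebesgue (ball x r) f" "set_integrable lebesgue (ball x r) g"
    and "\<And>y. y \<in> ball x r \<Longrightarrow> f y \<le> g y"
  shows "ball_avg f x r \<le> ball_avg g x r"
  unfolding ball_avg_def by (intro divide_right_mono set_integral_mono assms) auto

lemma ball_avg_cong:
  "(\<And>y. y \<in> ball x r \<Longrightarrow> f y = g y) \<Longrightarrow> ball_avg f x r = ball_avg g x r"
  unfolding ball_avg_def set_lebesgue_integral_def
  by (intro arg_cong2[where f = "(/)"] Bochner_Integration.integral_cong) (auto simp: indicator_def)

lemma ball_avg_add:
  assumes "set_integrable lebesgue (ball x r) f" "set_integrable lebesgue (ball x r) g"
  shows "ball_avg (\<lambda>y. f y + g y) x r = ball_avg f x r + ball_avg g x r"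
  unfolding ball_avg_def using assms by (simp add: set_integral_add add_divide_distrib)

lemma ball_avg_cmult: "ball_avg (\<lambda>y. c * f y) x r = c * ball_avg f x r"
  unfolding ball_avg_def by simp

lemma set_integrable_const_ball: "set_integrable lebesgue (ball x r) (\<lambda>_. c::real)"
  using lmeasurable_ball[of x r]
  unfolding set_integrable_def by (intro integrable_scaleR_left) (simp add: lmeasurable_iff_integrable)

lemma abs_ball_avg_diff_le:
  assumes F: "set_integrable lebesgue (ball x r) F" and r: "r > 0"
  shows "\<bar>ball_avg F x r - q\<bar> \<le> ball_avg (\<lambda>y. \<bar>F y - q\<bar>) x r"
proof -
  have int: "set_integrable lebesgue (ball x r) (\<lambda>y. F y + - q)" 
    by (intro set_integral_add(1) F set_integrable_const_ball)
  have "ball_avg F x r - q = ball_avg (\<lambda>y. F y + - q) x r"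
    using ball_avg_add[OF F set_integrable_const_ball, of "-q"] r by (simp add: ball_avg_const)
  also have "\<bar>\<dots>\<bar> \<le> ball_avg (\<lambda>y. \<bar>F y + - q\<bar>) x r"
    using int set_integral_norm_bound[OF int] unfolding ball_avg_def 
    by (simp add: divide_right_mono)
  finally show ?thesis by simp
qed

text \<open>The bound over balls loses a constant factor, so applied to \<open>F\<close> it cannot
  identify the limit of the averages. It is applied instead to \<open>\<bar>F y - q\<bar>\<close>
  for all rational \<open>q\<close>, which costs countably many null sets; a \<open>q\<close> close
  to \<open>F x\<close> then makes the bound small whatever the constant.\<close>

lemma ball_avg_tendsto_AE:
  fixes F :: "'a::euclidean_space \<Rightarrow> real"
  assumes F: "integrable lebesgue F"
  shows "AE x in lebesgue. (ball_avg F x \<longlongrightarrow> F x) (at_right 0)"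
proof -
  have intK: "set_integrable lebesgue S F" if "S \<in> sets lebesgue" for S
    using F that unfolding set_integrable_def by (intro integrable_mult_indicator) auto
  have int: "set_integrable lebesgue K (\<lambda>y. \<bar>F y - q\<bar>)" if "compact K" for K q
  proof -
    have "K \<in> lmeasurable" using that by (rule lmeasurable_compact)
    then have "set_integrable lebesgue K (\<lambda>_. q)"
      unfolding set_integrable_def by (intro integrable_scaleR_left) (simp add: lmeasurable_iff_integrable)
    then have "set_integrable lebesgue K (\<lambda>y. F y - q)"
      using intK[of K] \<open>K \<in> lmeasurable\<close> by (intro set_integral_diff(1)) auto
    then show ?thesis by (rule set_integrable_abs)
  qed
  have "AE x in lebesgue. \<forall>q\<in>\<rat>. \<forall>e>0. eventually (\<lambda>h. (LINT y:ball x h|lebesgue. \<bar>F y - q\<bar>)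
      \<le> (2 * h) ^ DIM('a) * (\<bar>F x - q\<bar> + e)) (at_right 0)"
    by (subst AE_ball_countable[OF countable_rat]) (intro ballI ball_integral_le_AE int, auto)
  then show ?thesis
  proof (elim AE_mp, intro AE_I2 impI)
    fix x
    assume A: "\<forall>q\<in>\<rat>. \<forall>e>0. eventually (\<lambda>h. (LINT y:ball x h|lebesgue. \<bar>F y - q\<bar>)
      \<le> (2 * h) ^ DIM('a) * (\<bar>F x - q\<bar> + e)) (at_right 0)"
    define v where "v = measure lebesgue (ball (0::'a) 1)"
    have v: "v > 0" unfolding v_def by (rule measure_ball_pos) simp
    \<comment> \<open>The ratio of the factor \<open>(2 * h) ^ DIM('a)\<close> to the volume of the
      ball, independent of \<open>h\<close>.\<close>
    define C where "C = 2 ^ DIM('a) / v"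
    have C: "C > 0" using v by (simp add: C_def)
    show "(ball_avg F x \<longlongrightarrow> F x) (at_right 0)"
    proof (rule tendstoI)
      fix e :: real assume e: "e > 0"
      \<comment> \<open>The average differs from \<open>q\<close> by less than
        \<open>C * (2 * \<eta>)\<close>, and \<open>q\<close> from \<open>F x\<close> by less than
        \<open>\<eta>\<close>; the two together must give \<open>e\<close>.\<close>
      define \<eta> where "\<eta> = e / (2 * C + 1)"
      have \<eta>: "\<eta> > 0" using e C by (simp add: \<eta>_def)
      obtain q where q: "q \<in> \<rat>" "\<bar>F x - q\<bar> < \<eta>"
        using \<eta> rational_approximation[of \<eta> "F x"] by (metis abs_minus_commute)
      have "eventually (\<lambda>h. (LINT y:ball x h|lebesgue. \<bar>F y - q\<bar>)
          \<le> (2 * h) ^ DIM('a) * (\<bar>F x - q\<bar> + \<eta>)) (at_right 0)"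
        using A q(1) \<eta> by blast
      moreover have "eventually (\<lambda>h. h > (0::real)) (at_right 0)"
        by (rule eventually_at_right_less)
      ultimately show "eventually (\<lambda>h. dist (ball_avg F x h) (F x) < e) (at_right 0)"
      proof eventually_elim
        case (elim h)
        have "\<bar>ball_avg F x h - q\<bar> \<le> ball_avg (\<lambda>y. \<bar>F y - q\<bar>) x h"
          using elim by (intro abs_ball_avg_diff_le intK) auto
        also have "\<dots> \<le> (2 * h) ^ DIM('a) * (\<bar>F x - q\<bar> + \<eta>) / (h ^ DIM('a) * v)"
          unfolding ball_avg_def measure_ball_eq[OF less_imp_le[OF elim(2)], of x] v_def[symmetric]
          using elim v by (intro divide_right_mono) auto
        also have "\<dots> = C * (\<bar>F x - q\<bar> + \<eta>)"
          using elim by (simp add: C_def power_mult_distrib)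
        also have "\<dots> < C * (2 * \<eta>)" using C q by simp
        finally have "\<bar>ball_avg F x h - F x\<bar> < C * (2 * \<eta>) + \<eta>"
          using q by linarith
        also have "\<dots> = (2 * C + 1) * \<eta>" by (simp add: algebra_simps)
        also have "\<dots> = e" using C by (simp add: \<eta>_def)
        finally show ?case by (simp add: dist_real_def)
      qed
    qed
  qed
qed

lemma precise_rep_eqI:
  assumes "(ball_avg f x \<longlongrightarrow> l) (at_right 0)"
  shows "precise_rep f x = l"
  using assms tendsto_Lim[OF _ assms] by (auto simp: precise_rep_def trivial_limit_at_right_real)

text \<open>Setting \<open>f\<close> to 0 outside \<open>V\<close> gives an integrable function on
  the whole space. Small balls around a point of the open set \<open>V\<close> stay in
  \<open>V\<close>, so the averages there are those of \<open>f\<close>.\<close>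

lemma precise_rep_eq_AE:
  fixes f :: "'a::euclidean_space \<Rightarrow> real"
  assumes V: "open V" and f: "set_integrable lebesgue V f"
  shows "AE x in lebesgue. x \<in> V \<longrightarrow> precise_rep f x = f x"
proof -
  let ?F = "\<lambda>x. indicator V x *\<^sub>R f x"
  have "AE x in lebesgue. (ball_avg ?F x \<longlongrightarrow> ?F x) (at_right 0)"
    using f unfolding set_integrable_def by (rule ball_avg_tendsto_AE)
  then show ?thesis
  proof (elim AE_mp, intro AE_I2 impI)
    fix x assume lim: "(ball_avg ?F x \<longlongrightarrow> ?F x) (at_right 0)" and x: "x \<in> V"
    obtain d where d: "d > 0" "ball x d \<subseteq> V" using V x openE by blast
    have "ball_avg ?F x h = ball_avg f x h" if "h \<in> {0<..<d}" for h
      using d(2) that by (intro ball_avg_cong) (auto simp: subset_iff)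
    then have "eventually (\<lambda>h. ball_avg ?F x h = ball_avg f x h) (at_right 0)"
      using eventually_at_right_real[OF d(1)] by (auto elim: eventually_mono)
    then have "(ball_avg f x \<longlongrightarrow> f x) (at_right 0)"
      using lim x by (auto elim: Lim_transform_eventually)
    then show "precise_rep f x = f x" by (rule precise_rep_eqI)
  qed
qed

section \<open>Integrability of p-th powers on balls\<close>

text \<open>The difference is at most twice the larger absolute value. This replaces convexity, at
  the price of a cruder constant.\<close>

lemma abs_diff_powr_le:
  fixes a b p :: real
  assumes "p \<ge> 0"
  shows "\<bar>a - b\<bar> powr p \<le> 2 powr p * (\<bar>a\<bar> powr p + \<bar>b\<bar> powr p)"
proof -
  define m where "m = max \<bar>a\<bar> \<bar>b\<bar>"
  have "\<bar>a - b\<bar> powr p \<le> (2 * m) powr p"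
    using assms by (intro powr_mono2) (auto simp: m_def)
  also have "\<dots> = 2 powr p * m powr p" by (simp add: powr_mult m_def)
  also have "m powr p \<le> \<bar>a\<bar> powr p + \<bar>b\<bar> powr p" by (simp add: m_def max_def)
  finally show ?thesis by simp
qed

lemma compactly_in_ball_exists:
  assumes "open \<Omega>" "x \<in> \<Omega>"
  obtains R where "R > 0" "compactly_in (ball x R) \<Omega>"
proof -
  obtain R where "R > 0" "cball x R \<subseteq> \<Omega>" using assms open_contains_cball by blast
  then show ?thesis by (intro that[of R]) (auto simp: compactly_in_def)
qed

lemma Lp_locD: "f \<in> Lp_loc p \<Omega> \<Longrightarrow> compactly_in V \<Omega> \<Longrightarrow> f \<in> Lp p V"
  by (simp add: Lp_loc_def)

text \<open>Balls have finite measure, so \<open>1 + \<bar>f y\<bar> powr p\<close> is an integrable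
  majorant of \<open>\<bar>f y\<bar>\<close>.\<close>

lemma Lp_ball_imp_set_integrable:
  fixes f :: "'a::euclidean_space \<Rightarrow> real"
  assumes f: "f \<in> Lp p (ball x R)" and p: "1 \<le> p"
  shows "set_integrable lebesgue (ball x R) f"
proof -
  let ?I = "\<lambda>y. indicator (ball x R) y :: real"
  have m: "(\<lambda>y. ?I y *\<^sub>R f y) \<in> borel_measurable lebesgue"
    and i: "integrable lebesgue (\<lambda>y. ?I y *\<^sub>R \<bar>f y\<bar> powr p)"
    using f by (auto simp: Lp_def set_borel_measurable_def set_integrable_def)
  have one: "integrable lebesgue (\<lambda>y. ?I y *\<^sub>R (1::real))"
    using set_integrable_const_ball[of x R 1] unfolding set_integrable_def .
  show ?thesis unfolding set_integrable_def
  proof (rule Bochner_Integration.integrable_bound[OF Bochner_Integration.integrable_add[OF one i] m], intro AE_I2)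
    fix y
    have "\<bar>f y\<bar> \<le> 1 + \<bar>f y\<bar> powr p"
    proof (cases "\<bar>f y\<bar> \<le> 1")
      case False
      then have "\<bar>f y\<bar> powr 1 \<le> \<bar>f y\<bar> powr p" using p by (intro powr_mono) auto
      then show ?thesis by simp
    qed (simp add: add_increasing2)
    then show "norm (?I y *\<^sub>R f y) \<le> norm (?I y *\<^sub>R 1 + ?I y *\<^sub>R \<bar>f y\<bar> powr p)"
      by (auto simp: indicator_def)
  qed
qed

lemma linear_measurable_lebesgue:
  fixes L :: "'a::euclidean_space \<Rightarrow> real"
  assumes "linear L"
  shows "(\<lambda>z. L (z - x)) \<in> borel_measurable lebesgue"
proof -
  have "continuous_on UNIV (\<lambda>z. L (z - x))"
    using linear_continuous_on_compose[OF _ assms, of UNIV "\<lambda>z. z - x"] by (simp add: continuous_intros)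
  then show ?thesis
    by (intro measurable_completion) (simp add: borel_measurable_continuous_onI)
qed

text \<open>The affine part is bounded by a constant \<open>K\<close> on the ball of radius
  \<open>R\<close>, which yields the majorant \<open>?b\<close>. Integrability has to be secured
  because divergent integrals have the value 0, which would spoil monotonicity and additivity of
  averages.\<close>

lemma Lp_ball_affine_error_integrable:
  fixes f :: "'a::euclidean_space \<Rightarrow> real"
  assumes f: "f \<in> Lp p (ball x R)" and p: "1 \<le> p" and L: "linear L" and r: "r \<le> R"
  shows "set_integrable lebesgue (ball x r) (\<lambda>z. \<bar>f z - c - L (z - x)\<bar> powr p / k)"
proof -
  let ?I = "\<lambda>y. indicator (ball x R) y :: real"
  have m: "(\<lambda>y. ?I y *\<^sub>R f y) \<in> borel_measurable lebesgue"
    and i: "integrable lebesgue (\<lambda>y. ?I y *\<^sub>R \<bar>f y\<bar> powr p)"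
    using f by (auto simp: Lp_def set_borel_measurable_def set_integrable_def)
  obtain B where B: "B > 0" "\<And>w. norm (L w) \<le> norm w * B"
    using bounded_linear.pos_bounded[OF linear_conv_bounded_linear[THEN iffD1, OF L]] by blast
  define K where "K = \<bar>c\<bar> + R * B"
  let ?b = "\<lambda>y. 2 powr p * (?I y *\<^sub>R \<bar>f y\<bar> powr p + ?I y *\<^sub>R K powr p)"
  have ib: "integrable lebesgue ?b"
    using set_integrable_const_ball[of x R "K powr p"] i unfolding set_integrable_def
    by (intro integrable_mult_right Bochner_Integration.integrable_add)
  have "set_integrable lebesgue (ball x R) (\<lambda>z. \<bar>f z - c - L (z - x)\<bar> powr p)"
    unfolding set_integrable_def
  proof (rule Bochner_Integration.integrable_bound[OF ib])
    \<comment> \<open>Only the cut-off of \<open>f\<close> to the ball is known to be measurable.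
      The cut-off is therefore also put inside the power, where the outer indicator makes it
      invisible.\<close>
    have "(\<lambda>z. ?I z *\<^sub>R \<bar>?I z *\<^sub>R f z - c - L (z - x)\<bar> powr p) \<in> borel_measurable lebesgue"
      by (intro borel_measurable_scaleR measurable_abs_powr borel_measurable_diff
          borel_measurable_indicator m linear_measurable_lebesgue[OF L]) auto
    also have "(\<lambda>z. ?I z *\<^sub>R \<bar>?I z *\<^sub>R f z - c - L (z - x)\<bar> powr p) = (\<lambda>z. ?I z *\<^sub>R \<bar>f z - c - L (z - x)\<bar> powr p)"
      by (auto simp: indicator_def)
    finally show "(\<lambda>z. ?I z *\<^sub>R \<bar>f z - c - L (z - x)\<bar> powr p) \<in> borel_measurable lebesgue" .
    show "AE z in lebesgue. norm (?I z *\<^sub>R \<bar>f z - c - L (z - x)\<bar> powr p) \<le> norm (?b z)"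
    proof (intro AE_I2)
      fix z
      show "norm (?I z *\<^sub>R \<bar>f z - c - L (z - x)\<bar> powr p) \<le> norm (?b z)"
      proof (cases "z \<in> ball x R")
        case True
        have "\<bar>L (z - x)\<bar> \<le> norm (z - x) * B" using B(2)[of "z - x"] by simp
        also have "\<dots> \<le> R * B" using True B(1) by (intro mult_right_mono) (auto simp: dist_norm norm_minus_commute)
        finally have "\<bar>c + L (z - x)\<bar> \<le> K" by (simp add: K_def)
        then have "\<bar>c + L (z - x)\<bar> powr p \<le> K powr p" using p by (intro powr_mono2) auto
        then have K: "2 powr p * (\<bar>f z\<bar> powr p + \<bar>c + L (z - x)\<bar> powr p) \<le> 2 powr p * (\<bar>f z\<bar> powr p + K powr p)"
          by (intro mult_left_mono) auto
        have "\<bar>f z - (c + L (z - x))\<bar> powr p \<le> 2 powr p * (\<bar>f z\<bar> powr p + \<bar>c + L (z - x)\<bar> powr p)"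
          using p by (intro abs_diff_powr_le) auto
        also note K
        finally have "\<bar>f z - c - L (z - x)\<bar> powr p \<le> 2 powr p * (\<bar>f z\<bar> powr p + K powr p)"
          by (simp add: diff_diff_eq)
        then show ?thesis using True by simp
      qed simp
    qed
  qed
  then have "set_integrable lebesgue (ball x r) (\<lambda>z. \<bar>f z - c - L (z - x)\<bar> powr p)"
    by (rule set_integrable_subset[OF _ _ subset_ball[OF r]]) auto
  then show ?thesis by (rule set_integrable_divide)
qed

section \<open>Formal differentials are L_p-differentials\<close>

text \<open>The Jacobian \<open>r ^ DIM('a)\<close> of the homothety cancels against the volume of
  the ball.\<close>

lemma ball_avg_rescale:
  fixes g :: "'a::euclidean_space \<Rightarrow> real"
  assumes r: "r > 0" and g: "set_borel_measurable lebesgue (ball x r) g"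
  shows "ball_avg g x r = ball_avg (\<lambda>z. g (x + r *\<^sub>R z)) 0 1"
proof -
  have ind: "indicator (ball x r) (x + r *\<^sub>R z) = (indicator (ball 0 1) z :: real)" for z
    using r by (auto simp: indicator_def dist_norm)
  have "(LINT y:ball x r|lebesgue. g y) = r ^ DIM('a) * (LINT z:ball 0 1|lebesgue. g (x + r *\<^sub>R z))"
    using integral_lebesgue_homothety[OF r g[unfolded set_borel_measurable_def], of x]
    unfolding set_lebesgue_integral_def ind .
  then show ?thesis
    using r unfolding ball_avg_def measure_ball_eq[OF less_imp_le[OF r], of x] by simp
qed

text \<open>The norm is infinite off the Sobolev space, so convergence to 0 forces membership
  eventually. From then on the norm is a real sum of nonnegative terms that dominates its first
  term, and a p-th power removes the root.\<close>

lemma W1p_norm_tendsto_0_imp_Lp: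
  assumes p: "1 \<le> p" and lim: "((\<lambda>h. W1p_norm p U (u h)) \<longlongrightarrow> 0) F"
  shows "eventually (\<lambda>h. u h \<in> Lp p U) F"
    and "((\<lambda>h. LINT y:U|lebesgue. \<bar>u h y\<bar> powr p) \<longlongrightarrow> 0) F"
proof -
  have "eventually (\<lambda>h. W1p_norm p U (u h) < 1) F"
    using lim by (rule order_tendstoD) simp
  then have ev: "eventually (\<lambda>h. u h \<in> W1p p U) F"
    by eventually_elim (auto simp: W1p_norm_def split: if_splits)
  then show "eventually (\<lambda>h. u h \<in> Lp p U) F"
    by eventually_elim (simp add: W1p_def)
  have "((\<lambda>h. enn2real (W1p_norm p U (u h))) \<longlongrightarrow> 0) F"
    using tendsto_enn2real[of _ 0] lim by simp
  moreover have "eventually (\<lambda>h. Lp_norm p U (u h) \<le> enn2real (W1p_norm p U (u h))) F"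
    using ev
  proof eventually_elim
    case (elim h)
    have "0 \<le> (\<Sum>b\<in>Basis. Lp_norm p U (weak_pderiv U b (u h)))"
      by (intro sum_nonneg) (simp add: Lp_norm_def)
    moreover have "0 \<le> Lp_norm p U (u h)" by (simp add: Lp_norm_def)
    ultimately show ?case using elim by (simp add: W1p_norm_def enn2real_ennreal del: ennreal_plus)
  qed
  moreover have "eventually (\<lambda>h. 0 \<le> Lp_norm p U (u h)) F" by (simp add: Lp_norm_def)
  ultimately have "((\<lambda>h. Lp_norm p U (u h)) \<longlongrightarrow> 0) F"
    by - (rule tendsto_sandwich[OF _ _ tendsto_const])
  then have "((\<lambda>h. Lp_norm p U (u h) powr p) \<longlongrightarrow> 0) F"
    using p by (intro tendsto_zero_powrI[where b = p]) (auto simp: Lp_norm_def)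
  moreover have "Lp_norm p U (u h) powr p = (LINT y:U|lebesgue. \<bar>u h y\<bar> powr p)" for h
  proof -
    have "0 \<le> (LINT y:U|lebesgue. \<bar>u h y\<bar> powr p)"
      unfolding set_lebesgue_integral_def by (intro Bochner_Integration.integral_nonneg) auto
    then show ?thesis using p by (simp add: Lp_norm_def powr_powr)
  qed
  ultimately show "((\<lambda>h. LINT y:U|lebesgue. \<bar>u h y\<bar> powr p) \<longlongrightarrow> 0) F" by simp
qed

lemma has_formal_differential_imp_has_Lp_differential:
  fixes \<Omega> :: "'a::euclidean_space set"
  assumes \<Omega>: "open \<Omega>" and p: "1 \<le> p" and D: "has_formal_differential p \<Omega> f x L"
  shows "has_Lp_differential p \<Omega> f x L"
proof -
  let ?c = "precise_rep f x" and ?B = "ball (0::'a) 1"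
  let ?u = "\<lambda>h z. rescaled f x h z - L z"
  let ?G = "\<lambda>h z. \<bar>f z - ?c - L (z - x)\<bar> powr p / h powr p"
  \<comment> \<open>The Sobolev limit is taken on the unit ball and restricted to positive
    \<open>h\<close>, since \<open>h\<close> will be the radius of a ball around
    \<open>x\<close>.\<close>
  have f: "f \<in> Lp_loc p \<Omega>" and x: "x \<in> \<Omega>" and L: "linear L"
    and lim: "((\<lambda>h. W1p_norm p ?B (?u h)) \<longlongrightarrow> 0) (at_right 0)"
    using D by (auto simp: has_formal_differential_def Lp_point_def
        intro!: filterlim_mono[OF _ order_refl at_le[of "{0<..}" UNIV]])
  obtain R where R: "R > 0" "compactly_in (ball x R) \<Omega>"
    using compactly_in_ball_exists[OF \<Omega> x] .
  have fR: "f \<in> Lp p (ball x R)" using Lp_locD[OF f R(2)] .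
  have ae: "AE y in lebesgue. y \<in> ball x R \<longrightarrow> precise_rep f y = f y"
    by (intro precise_rep_eq_AE Lp_ball_imp_set_integrable[OF fR p]) auto
  have "eventually (\<lambda>h. ball_avg (?G h) x h = (LINT z:?B|lebesgue. \<bar>?u h z\<bar> powr p) / measure lebesgue ?B) (at_right 0)"
    using W1p_norm_tendsto_0_imp_Lp(1)[OF p lim] eventually_at_right_real[OF R(1)]
  proof eventually_elim
    case (elim h)
    then have h: "h > 0" "h < R" by auto
    have "set_borel_measurable lebesgue (ball x h) (?G h)"
      using Lp_ball_affine_error_integrable[OF fR p L less_imp_le[OF h(2)], of ?c "h powr p"]
      by (auto simp: set_integrable_def set_borel_measurable_def dest: borel_measurable_integrable)
    then have "ball_avg (?G h) x h = ball_avg (\<lambda>z. ?G h (x + h *\<^sub>R z)) 0 1"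
      by (rule ball_avg_rescale[OF h(1)])
    also have "(LINT z:?B|lebesgue. ?G h (x + h *\<^sub>R z)) = (LINT z:?B|lebesgue. \<bar>?u h z\<bar> powr p)"
      unfolding set_lebesgue_integral_def
    proof (rule integral_cong_AE)
      show 1: "(\<lambda>z. indicator ?B z *\<^sub>R \<bar>?u h z\<bar> powr p) \<in> borel_measurable lebesgue"
        using elim(1) by (auto simp: Lp_def set_integrable_def dest: borel_measurable_integrable)
      \<comment> \<open>The null set where \<open>f\<close> and its precise representative differ is
        pulled back under the homothety.\<close>
      have "AE z in lebesgue. x + h *\<^sub>R z \<in> ball x R \<longrightarrow> precise_rep f (x + h *\<^sub>R z) = f (x + h *\<^sub>R z)"
        using AE_lebesgue_homothety[OF h(1) ae, of x] .
      then show 2: "AE z in lebesgue. indicator ?B z *\<^sub>R ?G h (x + h *\<^sub>R z) = indicator ?B z *\<^sub>R \<bar>?u h z\<bar> powr p"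
      proof (elim AE_mp, intro AE_I2 impI)
        fix z assume z: "x + h *\<^sub>R z \<in> ball x R \<longrightarrow> precise_rep f (x + h *\<^sub>R z) = f (x + h *\<^sub>R z)"
        show "indicator ?B z *\<^sub>R ?G h (x + h *\<^sub>R z) = indicator ?B z *\<^sub>R \<bar>?u h z\<bar> powr p"
        proof (cases "z \<in> ?B")
          case True
          \<comment> \<open>The point \<open>x + h *\<^sub>R z\<close> has to lie in
            \<open>ball x R\<close>, where the two representatives agree almost everywhere.\<close>
          have "h * norm z < h * 1" using True h by (intro mult_strict_left_mono) auto
          then have "h * norm z < R" using h by linarith
          then have "precise_rep f (x + h *\<^sub>R z) = f (x + h *\<^sub>R z)"
            using z h by (simp add: dist_norm)
          then have "?u h z = (f (x + h *\<^sub>R z) - ?c - L (h *\<^sub>R z)) / h"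
            using h by (simp add: rescaled_def linear_cmul[OF L] diff_divide_distrib)
          then have "\<bar>?u h z\<bar> powr p = ?G h (x + h *\<^sub>R z)"
            using h by (simp add: abs_divide powr_divide)
          then show ?thesis by simp
        qed simp
      qed
      \<comment> \<open>Lebesgue measure is complete, so measurability passes to a function that is
        equal almost everywhere.\<close>
      show "(\<lambda>z. indicator ?B z *\<^sub>R ?G h (x + h *\<^sub>R z)) \<in> borel_measurable lebesgue"
        by (rule borel_measurable_AE[OF 1]) (use 2 in \<open>auto elim: eventually_mono\<close>)
    qed
    then have "ball_avg (\<lambda>z. ?G h (x + h *\<^sub>R z)) 0 1
        = (LINT z:?B|lebesgue. \<bar>?u h z\<bar> powr p) / measure lebesgue ?B"
      by (simp only: ball_avg_def)
    finally show ?case .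
  qed
  moreover have "((\<lambda>h. (LINT z:?B|lebesgue. \<bar>?u h z\<bar> powr p) / measure lebesgue ?B) \<longlongrightarrow> 0 / measure lebesgue ?B) (at_right 0)"
    using measure_ball_pos[of 1 "0::'a"] W1p_norm_tendsto_0_imp_Lp(2)[OF p lim]
    by (intro tendsto_intros) auto
  ultimately have "((\<lambda>r. ball_avg (?G r) x r) \<longlongrightarrow> 0) (at_right 0)"
    by (simp add: tendsto_cong)
  then show ?thesis using f x L by (simp add: has_Lp_differential_def)
qed

section \<open>Uniqueness of the L_p-differential\<close>

text \<open>The points of the unit ball where \<open>M\<close> does not vanish form an open null
  set, which must be empty. Homogeneity carries the result to the whole space.\<close>

lemma linear_eq_0_if_AE_ball:
  fixes M :: "'a::euclidean_space \<Rightarrow> real"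
  assumes M: "linear M" and ae: "AE z in lebesgue. z \<in> ball 0 1 \<longrightarrow> M z = 0"
  shows "M z = 0"
proof -
  define S where "S = ball 0 1 \<inter> M -` (- {0})"
  have "open S" unfolding S_def
    by (intro open_Int open_vimage continuous_intros linear_continuous_on[OF linear_conv_bounded_linear[THEN iffD1, OF M]]) auto
  then have "AE z in lebesgue. z \<notin> S" using ae by (auto simp: S_def)
  then have "S \<in> null_sets lebesgue"
    using \<open>open S\<close> by (subst (asm) AE_iff_null_sets[symmetric]) auto
  then have "S = {}"
    using open_not_negligible[OF \<open>open S\<close>] by (auto simp: negligible_iff_null_sets)
  \<comment> \<open>This factor scales \<open>z\<close> into the open unit ball, also for
    \<open>z = 0\<close>.\<close>
  define t where "t = 1 / (norm z + 1)"
  have nz: "norm z + 1 > 0" by (simp add: add_nonneg_pos)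
  have "t > 0" "norm (t *\<^sub>R z) < 1" using nz by (auto simp: t_def divide_simps)
  moreover have "t *\<^sub>R z \<notin> S" using \<open>S = {}\<close> by blast
  ultimately have "M (t *\<^sub>R z) = 0" by (auto simp: S_def)
  then show ?thesis using \<open>t > 0\<close> by (simp add: linear_cmul[OF M])
qed

lemma has_Lp_differential_unique:
  fixes \<Omega> :: "'a::euclidean_space set"
  assumes \<Omega>: "open \<Omega>" and p: "1 \<le> p"
    and D1: "has_Lp_differential p \<Omega> f x L1" and D2: "has_Lp_differential p \<Omega> f x L2"
  shows "L1 = L2"
proof -
  let ?c = "precise_rep f x" and ?B = "ball (0::'a) 1"
  have f: "f \<in> Lp_loc p \<Omega>" and x: "x \<in> \<Omega>" and L1: "linear L1" and L2: "linear L2"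
    using D1 D2 by (auto simp: has_Lp_differential_def)
  \<comment> \<open>\<open>M (z - x)\<close> is the error of \<open>L1\<close> minus the error of
    \<open>L2\<close>: \<open>f\<close> and the constant cancel, so \<open>abs_diff_powr_le\<close>
    bounds its p-th power by those of the two errors.\<close>
  define M where "M z = L2 z - L1 z" for z
  have M: "linear M" unfolding M_def using L1 L2 by (rule linear_compose_sub[rotated])
  define G where "G = (\<lambda>L r z. \<bar>f z - ?c - L (z - x)\<bar> powr p / r powr p)"
  have l1: "((\<lambda>r. ball_avg (G L1 r) x r) \<longlongrightarrow> 0) (at_right 0)"
    and l2: "((\<lambda>r. ball_avg (G L2 r) x r) \<longlongrightarrow> 0) (at_right 0)"
    using D1 D2 by (auto simp: has_Lp_differential_def G_def)
  obtain R where R: "R > 0" "compactly_in (ball x R) \<Omega>"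
    using compactly_in_ball_exists[OF \<Omega> x] .
  have fR: "f \<in> Lp p (ball x R)" using Lp_locD[OF f R(2)] .
  \<comment> \<open>Up to sign, \<open>M\<close> is the affine error of the zero function, so its
    p-th power is integrable by the lemma on affine errors.\<close>
  have zero: "(\<lambda>_. 0) \<in> Lp p (ball y r)" for y :: 'a and r
    by (simp add: Lp_def set_borel_measurable_def set_integrable_def)
  have intM: "set_integrable lebesgue (ball y r) (\<lambda>z. \<bar>M (z - y)\<bar> powr p / k)" for y r k
    using Lp_ball_affine_error_integrable[OF zero p M order_refl, where c = 0] by simp
  \<comment> \<open>The left side does not contain \<open>r\<close>, while the right side tends to
    0.\<close>
  have "eventually (\<lambda>r. ball_avg (\<lambda>z. \<bar>M z\<bar> powr p) 0 1
      \<le> 2 powr p * (ball_avg (G L1 r) x r + ball_avg (G L2 r) x r)) (at_right 0)"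
    using eventually_at_right_real[OF R(1)]
  proof eventually_elim
    case (elim r)
    then have r: "r > 0" "r < R" by auto
    have iG: "set_integrable lebesgue (ball x r) (G L r)" if "linear L" for L
      unfolding G_def by (rule Lp_ball_affine_error_integrable[OF fR p that less_imp_le[OF r(2)]])
    have "ball_avg (\<lambda>z. \<bar>M (z - x)\<bar> powr p / r powr p) x r
        = ball_avg (\<lambda>z. \<bar>M ((x + r *\<^sub>R z) - x)\<bar> powr p / r powr p) 0 1"
      using intM[of x r "r powr p"]
      by (intro ball_avg_rescale r) (auto simp: set_integrable_def set_borel_measurable_def dest: borel_measurable_integrable)
    also have "\<dots> = ball_avg (\<lambda>z. \<bar>M z\<bar> powr p) 0 1"
      using r by (intro ball_avg_cong) (simp add: linear_cmul[OF M] abs_mult powr_mult)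
    finally have "ball_avg (\<lambda>z. \<bar>M z\<bar> powr p) 0 1 = ball_avg (\<lambda>z. \<bar>M (z - x)\<bar> powr p / r powr p) x r" ..
    also have "\<dots> \<le> ball_avg (\<lambda>z. 2 powr p * (G L1 r z + G L2 r z)) x r"
    proof (rule ball_avg_mono[OF intM])
      show "set_integrable lebesgue (ball x r) (\<lambda>z. 2 powr p * (G L1 r z + G L2 r z))"
        using iG[OF L1] iG[OF L2] by (intro set_integrable_mult_right set_integral_add(1))
      fix z
      have "\<bar>M (z - x)\<bar> powr p \<le> 2 powr p * (\<bar>f z - ?c - L1 (z - x)\<bar> powr p + \<bar>f z - ?c - L2 (z - x)\<bar> powr p)"
        using abs_diff_powr_le[of p "f z - ?c - L1 (z - x)" "f z - ?c - L2 (z - x)"] p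
        by (simp add: M_def)
      then have "\<bar>M (z - x)\<bar> powr p / r powr p \<le>
          2 powr p * (\<bar>f z - ?c - L1 (z - x)\<bar> powr p + \<bar>f z - ?c - L2 (z - x)\<bar> powr p) / r powr p"
        by (rule divide_right_mono) simp
      then show "\<bar>M (z - x)\<bar> powr p / r powr p \<le> 2 powr p * (G L1 r z + G L2 r z)"
        by (simp add: G_def add_divide_distrib distrib_left)
    qed
    also have "\<dots> = 2 powr p * (ball_avg (G L1 r) x r + ball_avg (G L2 r) x r)"
      by (simp only: ball_avg_cmult ball_avg_add[OF iG[OF L1] iG[OF L2]])
    finally show ?case .
  qed
  moreover have "((\<lambda>r. 2 powr p * (ball_avg (G L1 r) x r + ball_avg (G L2 r) x r)) \<longlongrightarrow> 2 powr p * (0 + 0)) (at_right 0)"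
    by (intro tendsto_intros l1 l2)
  ultimately have "ball_avg (\<lambda>z. \<bar>M z\<bar> powr p) 0 1 \<le> 2 powr p * (0 + 0)"
    by (intro tendsto_lowerbound) (auto simp: trivial_limit_at_right_real)
  then have "(LINT z:?B|lebesgue. \<bar>M z\<bar> powr p) \<le> 0"
    using measure_ball_pos[of 1 "0::'a"] unfolding ball_avg_def
    by (metis add_0 divide_pos_pos mult_zero_right not_le zero_less_one)
  moreover have "0 \<le> (LINT z:?B|lebesgue. \<bar>M z\<bar> powr p)"
    unfolding set_lebesgue_integral_def by (intro Bochner_Integration.integral_nonneg) auto
  ultimately have "(LINT z:?B|lebesgue. \<bar>M z\<bar> powr p) = 0" by simp
  then have "AE z in lebesgue. indicator ?B z *\<^sub>R \<bar>M z\<bar> powr p = 0"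
    using intM[of 0 1 1] unfolding set_lebesgue_integral_def set_integrable_def
    by (subst (asm) integral_nonneg_eq_0_iff_AE) auto
  then have "AE z in lebesgue. z \<in> ?B \<longrightarrow> M z = 0"
    by (auto elim!: eventually_mono simp: indicator_def)
  then have "M z = 0" for z by (rule linear_eq_0_if_AE_ball[OF M])
  then show ?thesis by (auto simp: M_def)
qed

section \<open>Approximate differentiability\<close>

text \<open>Local integrability gives measurability on compactly contained open sets. By Lindelof,
  countably many of them cover \<open>\<Omega>\<close>, and measurability can be glued along a
  countable cover.\<close>

lemma Lp_loc_set_borel_measurable:
  fixes \<Omega> :: "'a::euclidean_space set"
  assumes \<Omega>: "open \<Omega>" and f: "f \<in> Lp_loc p \<Omega>"
  shows "set_borel_measurable lebesgue \<Omega> f"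
proof -
  have "\<Union>{V. compactly_in V \<Omega>} = \<Omega>"
  proof
    show "\<Union>{V. compactly_in V \<Omega>} \<subseteq> \<Omega>"
      using closure_subset by (fastforce simp: compactly_in_def)
    show "\<Omega> \<subseteq> \<Union>{V. compactly_in V \<Omega>}"
    proof
      fix x assume "x \<in> \<Omega>"
      then obtain R where "R > 0" "compactly_in (ball x R) \<Omega>"
        using compactly_in_ball_exists[OF \<Omega>] by blast
      then show "x \<in> \<Union>{V. compactly_in V \<Omega>}" by (intro UnionI[of "ball x R"]) auto
    qed
  qed
  then obtain C where C: "C \<subseteq> {V. compactly_in V \<Omega>}" "countable C" "\<Union>C = \<Omega>"
    using Lindelof[of "{V. compactly_in V \<Omega>}"] by (auto simp: compactly_in_def)
  let ?g = "\<lambda>y. indicator \<Omega> y *\<^sub>R f y"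
  have "?g \<in> borel_measurable lebesgue"
  \<comment> \<open>The complement of \<open>\<Omega>\<close>, where the cut-off function is 0,
    completes the cover of the whole space.\<close>
  proof (rule measurable_piecewise_restrict[of "insert (- \<Omega>) C"])
    show "countable (insert (- \<Omega>) C)" using C(2) by simp
    show "space lebesgue \<subseteq> \<Union>(insert (- \<Omega>) C)" using C(3) by auto
    fix V assume V: "V \<in> insert (- \<Omega>) C"
    then have "open V \<or> V = - \<Omega>" using C(1) by (auto simp: compactly_in_def)
    then show s: "V \<inter> space lebesgue \<in> sets lebesgue" using \<Omega> by auto
    have "(\<lambda>y. indicator V y *\<^sub>R ?g y) \<in> borel_measurable lebesgue"
    proof (cases "V = - \<Omega>")
      case True
      then have "(\<lambda>y. indicator V y *\<^sub>R ?g y) = (\<lambda>_. 0)" by (auto simp: indicator_def)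
      then show ?thesis by simp
    next
      case False
      then have c: "compactly_in V \<Omega>" "V \<subseteq> \<Omega>" using V C by auto
      then have "(\<lambda>y. indicator V y *\<^sub>R ?g y) = (\<lambda>y. indicator V y *\<^sub>R f y)"
        by (intro ext) (auto split: split_indicator)
      then show ?thesis using Lp_locD[OF f c(1)] by (simp add: Lp_def set_borel_measurable_def)
    qed
    then show "?g \<in> borel_measurable (restrict_space lebesgue V)"
      using s by (subst borel_measurable_restrict_space_iff) auto
  qed
  then show ?thesis by (simp add: set_borel_measurable_def)
qed

lemma has_Lp_differential_imp_approx_differentiable:
  fixes \<Omega> :: "'a::euclidean_space set"
  assumes \<Omega>: "open \<Omega>" and p: "1 \<le> p" and D: "has_Lp_differential p \<Omega> f x L"
  shows "approx_differentiable \<Omega> f x"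
proof -
  let ?c = "precise_rep f x"
  have f: "f \<in> Lp_loc p \<Omega>" and x: "x \<in> \<Omega>" and L: "linear L"
    using D by (auto simp: has_Lp_differential_def)
  define G where "G = (\<lambda>r z. \<bar>f z - ?c - L (z - x)\<bar> powr p / r powr p)"
  have lim: "((\<lambda>r. ball_avg (G r) x r) \<longlongrightarrow> 0) (at_right 0)"
    using D by (auto simp: has_Lp_differential_def G_def)
  obtain R where R: "R > 0" "compactly_in (ball x R) \<Omega>"
    using compactly_in_ball_exists[OF \<Omega> x] .
  have fR: "f \<in> Lp p (ball x R)" using Lp_locD[OF f R(2)] .
  have "((\<lambda>r. measure lebesgue ({y \<in> \<Omega> - {x}. \<bar>f y - ?c - L (y - x)\<bar> / norm (y - x) > \<epsilon>} \<inter> ball x r)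
      / measure lebesgue (ball x r)) \<longlongrightarrow> 0) (at_right 0)" if \<epsilon>: "\<epsilon> > 0" for \<epsilon>
  proof (rule tendstoI)
    fix e :: real assume e: "e > 0"
    let ?A = "{y \<in> \<Omega> - {x}. \<bar>f y - ?c - L (y - x)\<bar> / norm (y - x) > \<epsilon>}"
    \<comment> \<open>With \<open>\<delta> \<le> 1\<close> and dimension at least 1, the inner ball
      has relative volume \<open>\<delta> ^ DIM('a) \<le> \<delta> \<le> e / 2\<close>.\<close>
    define \<delta> where "\<delta> = min (1/2) (e / 2)"
    have \<delta>: "\<delta> > 0" "\<delta> \<le> 1" "\<delta> \<le> e / 2" using e by (auto simp: \<delta>_def)
    have "\<delta> ^ DIM('a) \<le> \<delta> ^ 1" using \<delta> by (intro power_decreasing) (auto simp: Suc_le_eq)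
    then have \<delta>n: "\<delta> ^ DIM('a) \<le> e / 2" using \<delta> by simp
    \<comment> \<open>At a bad point with \<open>norm (y - x) \<ge> \<delta> * r\<close> the error
      is at least \<open>\<epsilon> * \<delta> * r\<close>, so \<open>G r\<close> is at least
      \<open>k\<close>. Chebyshev at level \<open>k\<close> bounds the density of such points by the
      average of \<open>G r\<close> over \<open>k\<close>, hence the threshold
      \<open>e / 2 * k\<close> below.\<close>
    define k where "k = (\<epsilon> * \<delta>) powr p"
    have k: "k > 0" using \<epsilon> \<delta> by (simp add: k_def)
    have "eventually (\<lambda>r. ball_avg (G r) x r < e / 2 * k) (at_right 0)"
      using lim e k by (intro order_tendstoD) auto
    then show "eventually (\<lambda>r. dist (measure lebesgue (?A \<inter> ball x r) / measure lebesgue (ball x r)) 0 < e) (at_right 0)"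
      using eventually_at_right_real[OF R(1)]
    proof eventually_elim
      case (elim r)
      then have r: "r > 0" "r < R" by auto
      let ?E = "{y \<in> ball x r. k \<le> G r y}"
      have iG: "set_integrable lebesgue (ball x r) (G r)"
        unfolding G_def by (rule Lp_ball_affine_error_integrable[OF fR p L less_imp_le[OF r(2)]])
      have mE: "measure lebesgue ?E \<le> (LINT y:ball x r|lebesgue. G r y) / k"
        using k by (intro integral_Markov_inequality'_measure iG) (auto simp: G_def)
      have E: "?E \<in> lmeasurable"
      proof (rule fmeasurableI2[OF lmeasurable_ball[of x r]])
        have "{y. k \<le> indicator (ball x r) y *\<^sub>R G r y} \<in> sets lebesgue"
          using borel_measurable_integrable[OF iG[unfolded set_integrable_def]]
          by (simp add: borel_measurable_iff_ge)
        \<comment> \<open>Positivity of \<open>k\<close> excludes the points outside the ball, where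
          the cut-off function is 0.\<close>
        also have "{y. k \<le> indicator (ball x r) y *\<^sub>R G r y} = ?E"
          using k by (auto simp: indicator_def split: if_splits)
        finally show "?E \<in> sets lebesgue" .
      qed auto
      have sub: "?A \<inter> ball x r \<subseteq> ball x (\<delta> * r) \<union> ?E"
      proof
        fix y assume y: "y \<in> ?A \<inter> ball x r"
        show "y \<in> ball x (\<delta> * r) \<union> ?E"
        proof (cases "y \<in> ball x (\<delta> * r)")
          case False
          then have "\<delta> * r \<le> norm (y - x)" by (simp add: dist_norm norm_minus_commute)
          then have "\<epsilon> * (\<delta> * r) \<le> \<epsilon> * norm (y - x)" using \<epsilon> by (intro mult_left_mono) auto
          also have "\<dots> \<le> \<bar>f y - ?c - L (y - x)\<bar>" using y by (auto simp: pos_less_divide_eq)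
          finally have "(\<epsilon> * \<delta> * r) powr p \<le> \<bar>f y - ?c - L (y - x)\<bar> powr p"
            using \<epsilon> \<delta> r p by (intro powr_mono2) (auto simp: mult.assoc)
          then have "k \<le> G r y" using \<epsilon> \<delta> r by (simp add: k_def G_def powr_mult pos_le_divide_eq)
          then show ?thesis using y by simp
        qed simp
      qed
      have "measure lebesgue (?A \<inter> ball x r) \<le> measure lebesgue (ball x (\<delta> * r) \<union> ?E)"
      \<comment> \<open>A non-measurable set has \<open>measure\<close> 0 by default, so the bound
        is trivial in that case.\<close>
      proof (cases "?A \<inter> ball x r \<in> sets lebesgue")
        case True
        then show ?thesis using sub E by (intro measure_mono_fmeasurable fmeasurable.Un lmeasurable_ball)
      qed (simp add: measure_notin_sets)
      also have "\<dots> \<le> measure lebesgue (ball x (\<delta> * r)) + measure lebesgue ?E"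
        using E by (intro measure_Un_le) auto
      finally have "measure lebesgue (?A \<inter> ball x r) / measure lebesgue (ball x r)
          \<le> (measure lebesgue (ball x (\<delta> * r)) + measure lebesgue ?E) / measure lebesgue (ball x r)"
        by (intro divide_right_mono) auto
      also have "\<dots> \<le> (measure lebesgue (ball x (\<delta> * r)) + (LINT y:ball x r|lebesgue. G r y) / k) / measure lebesgue (ball x r)"
        using mE by (intro divide_right_mono) auto
      also have "\<dots> = measure lebesgue (ball x (\<delta> * r)) / measure lebesgue (ball x r) + ball_avg (G r) x r / k"
        by (simp add: ball_avg_def add_divide_distrib)
      also have "measure lebesgue (ball x (\<delta> * r)) / measure lebesgue (ball x r) = \<delta> ^ DIM('a)"
        using measure_ball_eq[of "\<delta> * r" x] measure_ball_eq[of r x] measure_ball_pos[of 1 "0::'a"] \<delta> r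
        by (simp add: power_mult_distrib)
      also have "\<delta> ^ DIM('a) + ball_avg (G r) x r / k < e"
      proof -
        have "ball_avg (G r) x r / k < e / 2" using elim(1) k by (simp only: pos_divide_less_eq)
        then show ?thesis using \<delta>n by linarith
      qed
      finally show ?case by (simp add: dist_real_def)
    qed
  qed
  then show ?thesis
    using Lp_loc_set_borel_measurable[OF \<Omega> f] x L unfolding approx_differentiable_def by blast
qed

theorem theorem3p4:
  fixes \<Omega> :: "'a::euclidean_space set" and p :: real and f :: "'a \<Rightarrow> real" and x :: 'a
  assumes "open \<Omega>" and "1 \<le> p" and "f \<in> W1p_loc p \<Omega>"
    and "x \<in> \<Omega>" and "Lp_point p \<Omega> f x"
    and "W1p_differentiable p \<Omega> f x"
  shows "Lp_differentiable p \<Omega> f x \<and>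
         Lp_differential p \<Omega> f x = formal_differential p \<Omega> f x \<and>
         approx_differentiable \<Omega> f x"
proof -
  obtain L where formal: "has_formal_differential p \<Omega> f x L"
    using assms(6) by (auto simp: W1p_differentiable_def)
  note imp = has_formal_differential_imp_has_Lp_differential[OF assms(1,2)]
  have Lp: "has_Lp_differential p \<Omega> f x L" by (rule imp[OF formal])
  note unique = has_Lp_differential_unique[OF assms(1,2) _ Lp]
  have "Lp_differential p \<Omega> f x = L"
    unfolding Lp_differential_def by (rule the_equality) (fact Lp, erule unique)
  \<comment> \<open>Formal differentials inherit uniqueness: each of them is an L_p-differential and
    hence equal to \<open>L\<close>.\<close>
  moreover have "formal_differential p \<Omega> f x = L"
    unfolding formal_differential_def by (rule the_equality) (fact formal, erule unique[OF imp])
  ultimately show ?thesis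
    using Lp has_Lp_differential_imp_approx_differentiable[OF assms(1,2) Lp]
    by (auto simp: Lp_differentiable_def)
qed

end
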